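(* Let $\Gamma$ be a simple connected graph on $n$ vertices and let $\mathbf{G}$ be its combinatorial Green's function. Then $$\mathrm{Tr}(\mathbf{G})=\frac{1}{n\tau}\,|\mathbb{F}^*_2|,$$ where $\tau$ is the number of spanning trees of $\Gamma$ and $\mathbb{F}^*_2$ is the set of rooted spanning $2$-forests of $\Gamma$.
   Context: $\Gamma$ is a finite undirected simple unweighted graph, with adjacency matrix $A$, diagonal degree matrix $D$, and combinatorial Laplacian $L=D-A$. The combinatorial Green's function $\mathbf{G}$ is the Moore–Penrose pseudoinverse of $L$. A spanning $2$-forest is a subgraph containing all vertices of $\Gamma$, with no cycles and exactly two connected components. A rooted spanning $2$-forest is a spanning $2$-forest together with a choice of one vertex (the root) in each of its two components (equivalently, with all edges oriented towards the roots); the two components are unordered. *)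

theory Defs
  imports "HOL-Analysis.Analysis"
begin

text \<open>
  A graph has the whole (finite, nonempty) type \<open>'v\<close> as its vertex set and is given by its edge
  set, whose members are unordered pairs of distinct vertices. A spanning subgraph contains all
  vertices, so it is determined by, and identified with, a subset of the edge set.
\<close>

definition simple_graph :: "'v::finite set set \<Rightarrow> bool" where
  "simple_graph E \<longleftrightarrow> (\<forall>e\<in>E. card e = 2)"

definition adjacent :: "'v::finite set set \<Rightarrow> 'v \<Rightarrow> 'v \<Rightarrow> bool" where
  "adjacent E u v \<longleftrightarrow> {u, v} \<in> E"

definition degree :: "'v::finite set set \<Rightarrow> 'v \<Rightarrow> nat" where
  "degree E v = card {e \<in> E. v \<in> e}"

definition graph_component :: "'v::finite set set \<Rightarrow> 'v \<Rightarrow> 'v set" where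
  "graph_component E u = {v. (adjacent E)\<^sup>*\<^sup>* u v}"

definition graph_components :: "'v::finite set set \<Rightarrow> 'v set set" where
  "graph_components E = range (graph_component E)"

definition graph_connected :: "'v::finite set set \<Rightarrow> bool" where
  "graph_connected E \<longleftrightarrow> (\<forall>u v. (adjacent E)\<^sup>*\<^sup>* u v)"

text \<open>A cycle is listed without repeating its starting vertex at the end.\<close>

definition graph_cycle :: "'v::finite set set \<Rightarrow> 'v list \<Rightarrow> bool" where
  "graph_cycle E c \<longleftrightarrow>
     length c \<ge> 3 \<and> distinct c \<and> successively (adjacent E) c \<and> adjacent E (last c) (hd c)"

definition graph_forest :: "'v::finite set set \<Rightarrow> bool" where
  "graph_forest E \<longleftrightarrow> (\<nexists>c. graph_cycle E c)"

definition spanning_trees :: "'v::finite set set \<Rightarrow> 'v set set set" where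
  "spanning_trees E = {T. T \<subseteq> E \<and> graph_forest T \<and> graph_connected T}"

definition spanning_2_forests :: "'v::finite set set \<Rightarrow> 'v set set set" where
  "spanning_2_forests E = {F. F \<subseteq> E \<and> graph_forest F \<and> card (graph_components F) = 2}"

text \<open>
  The choice of roots is recorded as the set \<open>R\<close> of chosen vertices, one in each component, so the
  two components remain unordered.
\<close>

definition rooted_spanning_2_forests :: "'v::finite set set \<Rightarrow> ('v set set \<times> 'v set) set" where
  "rooted_spanning_2_forests E =
     {(F, R). F \<in> spanning_2_forests E \<and> (\<forall>C\<in>graph_components F. \<exists>!r. r \<in> C \<and> r \<in> R)}"

definition adjacency_matrix :: "'v::finite set set \<Rightarrow> real^'v^'v" where
  "adjacency_matrix E = (\<chi> i j. if adjacent E i j then 1 else 0)"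

definition degree_matrix :: "'v::finite set set \<Rightarrow> real^'v^'v" where
  "degree_matrix E = (\<chi> i j. if i = j then real (degree E i) else 0)"

definition laplacian :: "'v::finite set set \<Rightarrow> real^'v^'v" where
  "laplacian E = degree_matrix E - adjacency_matrix E"

text \<open>The four Penrose conditions; a real matrix has exactly one such \<open>X\<close>.\<close>

definition is_moore_penrose_inverse :: "real^'n^'m \<Rightarrow> real^'m^'n \<Rightarrow> bool" where
  "is_moore_penrose_inverse A X \<longleftrightarrow>
     A ** X ** A = A \<and> X ** A ** X = X \<and>
     transpose (A ** X) = A ** X \<and> transpose (X ** A) = X ** A"

definition moore_penrose_inverse :: "real^'n^'m \<Rightarrow> real^'m^'n" where
  "moore_penrose_inverse A = (THE X. is_moore_penrose_inverse A X)"

definition greens_function :: "'v::finite set set \<Rightarrow> real^'v^'v" where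
  "greens_function E = moore_penrose_inverse (laplacian E)"

end

theory Submission
  imports Defs
begin

text \<open>
  The trace is read off from an explicit formula for the Green's function, and no determinant
  enters. Let \<open>n\<close> be the number of vertices, \<open>\<tau>\<close> the number of spanning trees, \<open>R x w\<close> the number
  of spanning 2-forests that separate \<open>x\<close> from \<open>w\<close>, and \<open>P = I - J / n\<close> the orthogonal projection
  onto the vectors of coordinate sum zero, where \<open>J\<close> is the all-ones matrix. The core is the
  identity \<open>L R = C - 2 \<tau> I\<close>, where every row of \<open>C\<close> is constant
  (\<open>laplacian_mult_separation_matrix\<close>). It has a combinatorial proof by cut and paste. The entry
  of \<open>L R\<close> at \<open>x, w\<close> is the sum, over the neighbours \<open>y\<close> of \<open>x\<close>, of \<open>R x w - R y w\<close>. To this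
  difference contribute only the 2-forests in which \<open>x\<close> and \<open>y\<close> are separated, and they arise, each
  exactly once, by deleting the edge \<open>xy\<close> from a spanning tree \<open>T\<close> through this edge
  (\<open>bij_betw_tree_minus_edge\<close>). The contribution is \<open>1\<close> if \<open>w\<close> stays on the side of \<open>y\<close>, and
  \<open>-1\<close> otherwise. For a fixed tree \<open>T\<close>, a vertex \<open>w\<close> different from \<open>x\<close> lies behind exactly one of
  the tree edges at \<open>x\<close> (\<open>card_tree_edges_behind\<close>). Hence \<open>T\<close> contributes in total \<open>2 - deg x\<close> if
  \<open>w\<close> differs from \<open>x\<close>, and \<open>- deg x\<close> if \<open>w = x\<close>, with the degree taken in \<open>T\<close>.

  Multiplication by \<open>P\<close> from the right kills \<open>C\<close>, and \<open>L P = L = P L\<close>, so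
  \<open>G = - P R P / (2 \<tau>)\<close> satisfies \<open>L G = P\<close>. As \<open>G\<close> is symmetric, also \<open>G L = P\<close>, and the
  Penrose conditions follow (\<open>greens_function_eq\<close>). Since \<open>R\<close> has zero diagonal, the trace of
  \<open>P R P\<close> is \<open>-1 / n\<close> times the sum of all entries of \<open>R\<close>. This sum counts the 2-forests together
  with an ordered pair of vertices in different components, and so it counts each rooted spanning
  2-forest twice (\<open>sum_separation_matrix\<close>).
\<close>

section \<open>Reachability and edge insertion\<close>

abbreviation reach :: "'v::finite set set \<Rightarrow> 'v \<Rightarrow> 'v \<Rightarrow> bool" where
  "reach F \<equiv> (adjacent F)\<^sup>*\<^sup>*"

lemma adjacent_commute: "adjacent F a b \<longleftrightarrow> adjacent F b a"
  by (simp add: adjacent_def insert_commute)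

lemma simple_graph_irrefl: "simple_graph F \<Longrightarrow> {a, b} \<in> F \<Longrightarrow> a \<noteq> b"
  by (auto simp: simple_graph_def)

lemma simple_graph_subset: "simple_graph E \<Longrightarrow> F \<subseteq> E \<Longrightarrow> simple_graph F"
  by (auto simp: simple_graph_def)

lemma simple_graph_edgeE:
  assumes "simple_graph F" "e \<in> F"
  obtains a b where "e = {a, b}" "a \<noteq> b"
  using assms by (auto simp: simple_graph_def card_2_iff)

lemma reach_sym: "reach F a b \<Longrightarrow> reach F b a"
  by (rule sympD[OF symp_rtranclp]) (auto intro: sympI simp: adjacent_commute)

lemma reach_commute: "reach F a b \<longleftrightarrow> reach F b a"
  by (rule iffI[OF reach_sym reach_sym])

lemma reach_trans: "reach F a b \<Longrightarrow> reach F b c \<Longrightarrow> reach F a c"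
  by (rule rtranclp_trans)

lemma reach_cong: "reach F a b \<Longrightarrow> reach F a v \<longleftrightarrow> reach F b v"
  by (rule iffI[OF reach_trans[OF reach_sym] reach_trans])

lemma reach_edge: "{a, b} \<in> F \<Longrightarrow> reach F a b"
  by (auto simp: adjacent_def)

lemma reach_mono: "reach F a b \<Longrightarrow> F \<subseteq> F' \<Longrightarrow> reach F' a b"
  by (erule rtranclp_mono[THEN predicate2D, rotated]) (auto simp: adjacent_def)

text \<open>
  A walk that uses the new edge can be shortened so that it uses it only once, in one of the two
  directions.
\<close>

lemma reach_insertD:
  assumes "reach (insert {x, y} F) a b"
  shows "reach F a b \<or> (reach F a x \<and> reach F y b) \<or> (reach F a y \<and> reach F x b)"
  using assms
proof (induction rule: rtranclp_induct)
  case (step b c)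
  from step.hyps(2) consider "{b, c} \<in> F" | "b = x" "c = y" | "b = y" "c = x"
    by (auto simp: adjacent_def doubleton_eq_iff)
  then show ?case
  proof cases
    case 1
    then show ?thesis
      using step.IH reach_edge reach_trans by metis
  qed (use step.IH reach_trans in auto)
qed auto

section \<open>Forests as graphs all of whose edges are bridges\<close>

lemma successively_conv_nth:
  "successively R c \<longleftrightarrow> (\<forall>i. Suc i < length c \<longrightarrow> R (c ! i) (c ! Suc i))"
proof (induction c rule: induct_list012)
  case (3 a b c)
  then show ?case by (simp add: All_less_Suc2 flip: less_eq_Suc_le)
qed auto

lemma successively_imp_rtranclp:
  "successively R c \<Longrightarrow> c \<noteq> [] \<Longrightarrow> R\<^sup>*\<^sup>* (hd c) (last c)"
proof (induction c rule: induct_list012)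
  case (3 a b c)
  then show ?case by (auto intro: converse_rtranclp_into_rtranclp)
qed auto

lemma rtranclp_imp_distinct_path:
  assumes "R\<^sup>*\<^sup>* a b"
  shows "\<exists>c. c \<noteq> [] \<and> distinct c \<and> successively R c \<and> hd c = a \<and> last c = b"
  using assms
proof (induction rule: converse_rtranclp_induct)
  case base
  show ?case by (rule exI[of _ "[b]"]) auto
next
  case (step a a')
  then obtain c where c: "c \<noteq> []" "distinct c" "successively R c" "hd c = a'" "last c = b"
    by blast
  show ?case
  proof (cases "a \<in> set c")
    case True
    then obtain c1 c2 where "c = c1 @ a # c2"
      by (auto simp: in_set_conv_decomp)
    with c show ?thesis
      by (intro exI[of _ "a # c2"]) (auto simp: successively_append_iff)
  next
    case False
    with c step.hyps show ?thesis
      by (intro exI[of _ "a # c"]) (auto simp: successively_Cons)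
  qed
qed

text \<open>
  A cycle is an edge together with a path joining its ends that avoids the edge. Stated through
  bridges, acyclicity speaks only of reachability, and the later arguments need no lists of
  vertices.
\<close>

lemma graph_forest_iff_bridges:
  assumes "simple_graph T"
  shows "graph_forest T \<longleftrightarrow> (\<forall>x y. {x, y} \<in> T \<longrightarrow> \<not> reach (T - {{x, y}}) x y)"
proof (intro iffI allI impI notI)
  fix x y
  assume forest: "graph_forest T" and e: "{x, y} \<in> T" and r: "reach (T - {{x, y}}) x y"
  obtain c where c: "c \<noteq> []" "distinct c" "successively (adjacent (T - {{x, y}})) c"
      "hd c = x" "last c = y"
    using rtranclp_imp_distinct_path[OF r] by blast
  have xy: "x \<noteq> y" using assms e by (rule simple_graph_irrefl)
  have "length c \<ge> 3"
  proof (rule ccontr)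
    assume "\<not> length c \<ge> 3"
    then have "length c = 1 \<or> length c = 2"
      using c(1) by (simp add: not_le less_Suc_eq numeral_3_eq_3 numeral_2_eq_2)
    then show False
      using c xy by (auto simp: length_Suc_conv numeral_2_eq_2 adjacent_def)
  qed
  moreover have "successively (adjacent T) c"
    using c(3) by (rule successively_mono) (auto simp: adjacent_def)
  moreover have "adjacent T (last c) (hd c)"
    using e c(4,5) by (simp add: adjacent_def insert_commute)
  ultimately show False
    using forest c(2) by (auto simp: graph_forest_def graph_cycle_def)
next
  assume bridges: "\<forall>x y. {x, y} \<in> T \<longrightarrow> \<not> reach (T - {{x, y}}) x y"
  show "graph_forest T"
    unfolding graph_forest_def
  proof
    assume "\<exists>c. graph_cycle T c"
    then obtain c where c: "length c \<ge> 3" "distinct c" "successively (adjacent T) c"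
        "adjacent T (last c) (hd c)"
      by (auto simp: graph_cycle_def)
    have ne: "c \<noteq> []" using c(1) by auto
    let ?e = "{hd c, last c}"
    have "adjacent (T - {?e}) (c ! i) (c ! Suc i)" if "Suc i < length c" for i
    proof -
      have "adjacent T (c ! i) (c ! Suc i)"
        using c(3) that by (simp add: successively_conv_nth)
      moreover have "{c ! i, c ! Suc i} \<noteq> {c ! 0, c ! (length c - 1)}"
      proof
        assume "{c ! i, c ! Suc i} = {c ! 0, c ! (length c - 1)}"
        then have "c ! i = c ! 0 \<and> c ! Suc i = c ! (length c - 1) \<or> c ! Suc i = c ! 0"
          by (auto simp: doubleton_eq_iff)
        moreover have "0 < length c" "length c - 1 < length c" "i < length c"
          using that by auto
        ultimately have "i = 0 \<and> Suc i = length c - 1 \<or> Suc i = 0"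
          using that by (simp only: nth_eq_iff_index_eq[OF c(2)])
        then show False using c(1) by auto
      qed
      ultimately show ?thesis
        using ne by (simp add: adjacent_def hd_conv_nth last_conv_nth)
    qed
    then have "successively (adjacent (T - {?e})) c"
      by (simp add: successively_conv_nth)
    then have "reach (T - {?e}) (hd c) (last c)"
      using ne by (rule successively_imp_rtranclp)
    moreover have "?e \<in> T"
      using c(4) by (simp add: adjacent_def insert_commute)
    ultimately show False using bridges by blast
  qed
qed

lemma forest_bridge:
  "simple_graph T \<Longrightarrow> graph_forest T \<Longrightarrow> {x, y} \<in> T \<Longrightarrow> \<not> reach (T - {{x, y}}) x y"
  by (simp add: graph_forest_iff_bridges)

lemma graph_forest_subset: "graph_forest T \<Longrightarrow> F \<subseteq> T \<Longrightarrow> graph_forest F"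
  unfolding graph_forest_def graph_cycle_def
  by (metis adjacent_def subsetD successively_mono)

text \<open>
  A connected edge set that is minimal under inclusion has only bridges. This makes \<open>\<tau>\<close> nonzero,
  so that division by it is legitimate.
\<close>

lemma spanning_tree_exists:
  assumes "simple_graph E" "graph_connected E"
  shows "spanning_trees E \<noteq> {}"
proof -
  let ?S = "{T. T \<subseteq> E \<and> graph_connected T}"
  obtain T where T: "T \<in> ?S" and min: "\<And>T'. T' \<in> ?S \<Longrightarrow> T' \<subseteq> T \<Longrightarrow> T = T'"
    using finite_has_minimal[of ?S] assms(2) by auto
  have simple: "simple_graph T"
    using assms(1) T by (auto intro: simple_graph_subset)
  have "\<not> reach (T - {{x, y}}) x y" if e: "{x, y} \<in> T" for x y
  proof
    assume r: "reach (T - {{x, y}}) x y"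
    have "reach (T - {{x, y}}) a b" for a b
    proof -
      have "reach (insert {x, y} (T - {{x, y}})) a b"
        using T e by (simp add: graph_connected_def insert_absorb)
      from reach_insertD[OF this] show ?thesis
        using r reach_sym reach_trans by metis
    qed
    then have "T - {{x, y}} \<in> ?S"
      using T by (auto simp: graph_connected_def)
    then show False using min[of "T - {{x, y}}"] e by auto
  qed
  then have "graph_forest T"
    using simple by (simp add: graph_forest_iff_bridges)
  then show ?thesis using T by (auto simp: spanning_trees_def)
qed

section \<open>The tree edge behind which a vertex lies\<close>

text \<open>
  The edge sought is the last one of a walk from \<open>w\<close> that stops when it first meets \<open>x\<close>: the part
  of the walk before it avoids \<open>x\<close>, hence avoids every edge at \<open>x\<close>.
\<close>

lemma tree_edge_behind_exists:
  assumes "reach T w x" "w \<noteq> x"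
  shows "\<exists>y. {x, y} \<in> T \<and> reach (T - {{x, y}}) w y"
  using assms
proof (induction rule: converse_rtranclp_induct)
  case (step w w')
  show ?case
  proof (cases "w' = x")
    case True
    with step.hyps show ?thesis by (auto simp: adjacent_def insert_commute)
  next
    case False
    then obtain y where y: "{x, y} \<in> T" "reach (T - {{x, y}}) w' y"
      using step.IH by auto
    have "adjacent (T - {{x, y}}) w w'"
      using step.hyps step.prems False by (auto simp: adjacent_def doubleton_eq_iff)
    then show ?thesis
      using y by (meson converse_rtranclp_into_rtranclp)
  qed
qed auto

text \<open>
  If \<open>w\<close> were joined both to \<open>y\<close> without using \<open>xy\<close> and, for another neighbour \<open>z\<close> of \<open>x\<close>, to \<open>z\<close>
  without using \<open>xz\<close>, then neither
  connection could use the other edge, as it would pass through \<open>x\<close>. Both would survive the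
  deletion of the two edges, and \<open>x, z, w, y\<close> would bypass the edge \<open>xy\<close>.
\<close>

lemma tree_edge_behind_unique:
  assumes "simple_graph T" "graph_forest T"
    and y: "{x, y} \<in> T" "reach (T - {{x, y}}) w y"
    and z: "{x, z} \<in> T" "reach (T - {{x, z}}) w z"
  shows "y = z"
proof (rule ccontr)
  assume "y \<noteq> z"
  have aux: "reach (T - {{x, y}} - {{x, z}}) w y"
    if "y \<noteq> z" "{x, y} \<in> T" "reach (T - {{x, y}}) w y" "{x, z} \<in> T" for y z
  proof -
    let ?F = "T - {{x, y}}" and ?F' = "T - {{x, y}} - {{x, z}}"
    have xz: "{x, z} \<in> ?F"
      using that by (auto simp: doubleton_eq_iff)
    have wx: "\<not> reach ?F w x"
      using forest_bridge[OF assms(1,2) that(2)] that(3) reach_sym reach_trans by metis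
    have wz: "\<not> reach ?F w z"
      using wx xz reach_edge reach_sym reach_trans by metis
    have "reach (insert {x, z} ?F') w y"
      using that(3) xz by (simp add: insert_absorb)
    then have "reach ?F' w y \<or> reach ?F' w x \<or> reach ?F' w z"
      using reach_insertD by metis
    moreover have "reach ?F' w v \<Longrightarrow> reach ?F w v" for v
      by (rule reach_mono) auto
    ultimately show ?thesis using wx wz by blast
  qed
  have "reach (T - {{x, y}} - {{x, z}}) w y"
    using aux[OF \<open>y \<noteq> z\<close> y z(1)] .
  moreover have "reach (T - {{x, y}} - {{x, z}}) w z"
  proof -
    have "T - {{x, z}} - {{x, y}} = T - {{x, y}} - {{x, z}}" by auto
    then show ?thesis using aux[OF \<open>y \<noteq> z\<close>[symmetric] z y(1)] by (simp only:)
  qed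
  ultimately have "reach (T - {{x, y}} - {{x, z}}) z y"
    by (rule reach_trans[OF reach_sym, rotated])
  then have "reach (T - {{x, y}}) z y"
    by (rule reach_mono) auto
  moreover have "{x, z} \<in> T - {{x, y}}"
    using z(1) \<open>y \<noteq> z\<close> by (auto simp: doubleton_eq_iff)
  ultimately have "reach (T - {{x, y}}) x y"
    using reach_edge reach_trans by metis
  then show False using forest_bridge[OF assms(1,2) y(1)] by simp
qed

lemma card_tree_edges_behind:
  assumes "simple_graph T" "graph_forest T" "graph_connected T"
  shows "card {y. {x, y} \<in> T \<and> reach (T - {{x, y}}) w y} = (if w = x then 0 else 1)"
proof (cases "w = x")
  case True
  then show ?thesis using forest_bridge[OF assms(1,2)] by auto
next
  case False
  have "reach T w x" using assms(3) by (simp add: graph_connected_def)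
  then obtain y where "{x, y} \<in> T \<and> reach (T - {{x, y}}) w y"
    using tree_edge_behind_exists False by blast
  then have "{y. {x, y} \<in> T \<and> reach (T - {{x, y}}) w y} = {y}"
    using tree_edge_behind_unique[OF assms(1,2)] by blast
  then show ?thesis using False by simp
qed

section \<open>Cutting a spanning tree and joining a 2-forest\<close>

lemma graph_component_eq_iff: "graph_component F a = graph_component F b \<longleftrightarrow> reach F a b"
proof
  assume "graph_component F a = graph_component F b"
  moreover have "b \<in> graph_component F b" by (simp add: graph_component_def)
  ultimately show "reach F a b" by (auto simp: graph_component_def)
next
  assume "reach F a b"
  then have "reach F a v \<longleftrightarrow> reach F b v" for v by (rule reach_cong)
  then show "graph_component F a = graph_component F b" by (simp add: graph_component_def)
qed

lemma tree_minus_edge_reach: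
  assumes "graph_connected T" "{x, y} \<in> T"
  shows "reach (T - {{x, y}}) w x \<or> reach (T - {{x, y}}) w y"
proof -
  have "reach (insert {x, y} (T - {{x, y}})) w x"
    using assms by (simp add: graph_connected_def insert_absorb)
  from reach_insertD[OF this] show ?thesis by blast
qed

lemma two_components_reach:
  assumes "card (graph_components F) = 2" "\<not> reach F x y"
  shows "reach F w x \<or> reach F w y"
proof (rule ccontr)
  assume "\<not> ?thesis"
  then have "card {graph_component F x, graph_component F y, graph_component F w} = 3"
    using assms(2) reach_sym by (auto simp: graph_component_eq_iff card_insert_if)
  moreover have "{graph_component F x, graph_component F y, graph_component F w} \<subseteq> graph_components F"
    by (auto simp: graph_components_def)
  ultimately have "3 \<le> card (graph_components F)"
    by (metis card_mono finite)
  then show False using assms(1) by simp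
qed

lemma spanning_tree_minus_edge:
  assumes "simple_graph E" "T \<in> spanning_trees E" "{x, y} \<in> T"
  shows "T - {{x, y}} \<in> spanning_2_forests E" "\<not> reach (T - {{x, y}}) x y"
proof -
  let ?F = "T - {{x, y}}"
  have T: "T \<subseteq> E" "graph_forest T" "graph_connected T"
    using assms(2) by (auto simp: spanning_trees_def)
  show nr: "\<not> reach ?F x y"
    using forest_bridge simple_graph_subset assms T by metis
  have "graph_component ?F w \<in> {graph_component ?F x, graph_component ?F y}" for w
    using tree_minus_edge_reach[OF T(3) assms(3)] by (simp add: graph_component_eq_iff)
  then have "graph_components ?F = {graph_component ?F x, graph_component ?F y}"
    unfolding graph_components_def by blast
  then have "card (graph_components ?F) = 2"
    using nr by (simp add: graph_component_eq_iff)
  moreover have "graph_forest ?F" using T(2) by (rule graph_forest_subset) auto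
  ultimately show "?F \<in> spanning_2_forests E"
    using T(1) by (auto simp: spanning_2_forests_def)
qed

text \<open>
  The inserted edge meets both components, so the result is connected. It creates no cycle: an old
  edge \<open>ab\<close> that stopped being a bridge would have to be bypassed through \<open>xy\<close>, and then \<open>x\<close> and \<open>y\<close>
  would already be joined in the forest by way of \<open>ab\<close>.
\<close>

lemma spanning_2_forest_insert_edge:
  assumes "simple_graph E" "F \<in> spanning_2_forests E" "\<not> reach F x y" "{x, y} \<in> E"
  shows "insert {x, y} F \<in> spanning_trees E"
proof -
  let ?T = "insert {x, y} F"
  have F: "F \<subseteq> E" "graph_forest F" "card (graph_components F) = 2"
    using assms(2) by (auto simp: spanning_2_forests_def)
  have TE: "?T \<subseteq> E" using F(1) assms(4) by auto
  have xy: "reach ?T x y" by (rule reach_edge) auto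
  have wx: "reach ?T w x" for w
    using two_components_reach[OF F(3) assms(3), of w] xy reach_sym reach_trans
      reach_mono[of F _ _ ?T] by (metis subset_insertI)
  have conn: "graph_connected ?T"
    unfolding graph_connected_def using wx reach_sym reach_trans by metis
  have nin: "{x, y} \<notin> F" using assms(3) reach_edge by metis
  have "\<not> reach (?T - {{a, b}}) a b" if ab: "{a, b} \<in> ?T" for a b
  proof (cases "{a, b} = {x, y}")
    case True
    then have "?T - {{a, b}} = F" using nin by auto
    then show ?thesis
      using True assms(3) reach_sym by (metis doubleton_eq_iff)
  next
    case False
    then have abF: "{a, b} \<in> F" using ab by auto
    have eq: "?T - {{a, b}} = insert {x, y} (F - {{a, b}})"
      using False by auto
    have up: "reach (F - {{a, b}}) c d \<Longrightarrow> reach F c d" for c d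
      by (rule reach_mono) auto
    show ?thesis
    proof
      assume "reach (?T - {{a, b}}) a b"
      from reach_insertD[OF this[unfolded eq]] consider "reach (F - {{a, b}}) a b"
        | "reach F a x" "reach F y b" | "reach F a y" "reach F x b"
        using up by blast
      then show False
      proof cases
        case 1
        then show False
          using forest_bridge simple_graph_subset assms(1) F(1,2) abF by metis
      qed (use reach_edge[OF abF] assms(3) reach_sym reach_trans in metis)+
    qed
  qed
  then have "graph_forest ?T"
    using graph_forest_iff_bridges simple_graph_subset[OF assms(1) TE] by blast
  then show ?thesis using TE conn by (simp add: spanning_trees_def)
qed

lemma bij_betw_tree_minus_edge:
  assumes "simple_graph E" "{x, y} \<in> E"
  shows "bij_betw (\<lambda>T. T - {{x, y}}) {T \<in> spanning_trees E. {x, y} \<in> T}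
    {F \<in> spanning_2_forests E. \<not> reach F x y}"
proof (rule bij_betw_byWitness[where f' = "insert {x, y}"])
  have "{x, y} \<notin> F" if "\<not> reach F x y" for F
    using that reach_edge by metis
  then show "\<forall>F\<in>{F \<in> spanning_2_forests E. \<not> reach F x y}. insert {x, y} F - {{x, y}} = F"
    by auto
  show "(\<lambda>T. T - {{x, y}}) ` {T \<in> spanning_trees E. {x, y} \<in> T}
      \<subseteq> {F \<in> spanning_2_forests E. \<not> reach F x y}"
    using spanning_tree_minus_edge[OF assms(1)] by blast
  show "insert {x, y} ` {F \<in> spanning_2_forests E. \<not> reach F x y}
      \<subseteq> {T \<in> spanning_trees E. {x, y} \<in> T}"
    using spanning_2_forest_insert_edge[OF assms(1) _ _ assms(2)] by blast
qed auto

section \<open>The Laplacian of the separation numbers\<close>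

text \<open>
  For a connected graph, division by \<open>\<tau>\<close> gives the matrix of effective resistances of the graph with unit conductances.
\<close>

definition separation_matrix :: "'v::finite set set \<Rightarrow> real^'v^'v" where
  "separation_matrix E = (\<chi> x w. real (card {F \<in> spanning_2_forests E. \<not> reach F x w}))"

text \<open>
  Forests in which \<open>x\<close> and \<open>y\<close> are joined cancel. Any other one is \<open>T\<close> minus the edge \<open>xy\<close> for a
  unique spanning tree \<open>T\<close>, and \<open>w\<close> is then joined to exactly one of \<open>x\<close> and \<open>y\<close>.
\<close>

lemma separation_matrix_diff:
  assumes "simple_graph E" "{x, y} \<in> E"
  shows "separation_matrix E $ x $ w - separation_matrix E $ y $ w =
    (\<Sum>T | T \<in> spanning_trees E \<and> {x, y} \<in> T. 2 * of_bool (reach (T - {{x, y}}) w y) - 1)"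
proof -
  let ?S = "spanning_2_forests E"
  let ?d = "\<lambda>F. of_bool (\<not> reach F x w) - of_bool (\<not> reach F y w) :: real"
  have sep: "separation_matrix E $ z $ w = (\<Sum>F\<in>?S. of_bool (\<not> reach F z w))" for z
    by (simp add: separation_matrix_def Int_def of_bool_def sum.If_cases)
  have "separation_matrix E $ x $ w - separation_matrix E $ y $ w = (\<Sum>F\<in>?S. ?d F)"
    by (simp add: sep sum_subtractf)
  also have "\<dots> = (\<Sum>F | F \<in> ?S \<and> \<not> reach F x y. ?d F)"
  proof (rule sum.mono_neutral_right)
    show "\<forall>F\<in>?S - {F \<in> ?S. \<not> reach F x y}. ?d F = 0"
    proof
      fix F assume "F \<in> ?S - {F \<in> ?S. \<not> reach F x y}"
      then have "reach F x y" by auto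
      then have "reach F x w = reach F y w" by (rule reach_cong)
      then show "?d F = 0" by simp
    qed
  qed auto
  also have "\<dots> = (\<Sum>T | T \<in> spanning_trees E \<and> {x, y} \<in> T. ?d (T - {{x, y}}))"
    using sum.reindex_bij_betw[OF bij_betw_tree_minus_edge[OF assms], of ?d] by simp
  also have "\<dots> = (\<Sum>T | T \<in> spanning_trees E \<and> {x, y} \<in> T. 2 * of_bool (reach (T - {{x, y}}) w y) - 1)"
  proof (rule sum.cong)
    fix T assume "T \<in> {T \<in> spanning_trees E. {x, y} \<in> T}"
    then have T: "T \<in> spanning_trees E" "{x, y} \<in> T" by auto
    let ?F = "T - {{x, y}}"
    have "\<not> reach ?F x y" using spanning_tree_minus_edge[OF assms(1) T] by simp
    moreover have "reach ?F w x \<or> reach ?F w y"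
      using tree_minus_edge_reach T by (auto simp: spanning_trees_def)
    ultimately have "reach ?F y w \<longleftrightarrow> reach ?F w y" "reach ?F x w \<longleftrightarrow> \<not> reach ?F w y"
      using reach_sym reach_trans by metis+
    then show "?d ?F = 2 * of_bool (reach ?F w y) - 1" by simp
  qed simp
  finally show ?thesis .
qed

lemma degree_eq_card_neighbours:
  assumes "simple_graph E"
  shows "degree E x = card {y. {x, y} \<in> E}"
proof -
  have "bij_betw (\<lambda>y. {x, y}) {y. {x, y} \<in> E} {e \<in> E. x \<in> e}"
    unfolding bij_betw_def
  proof
    show "inj_on (\<lambda>y. {x, y}) {y. {x, y} \<in> E}"
      by (auto simp: inj_on_def doubleton_eq_iff)
    show "(\<lambda>y. {x, y}) ` {y. {x, y} \<in> E} = {e \<in> E. x \<in> e}"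
    proof (intro equalityI subsetI)
      fix e assume "e \<in> {e \<in> E. x \<in> e}"
      moreover from this obtain a b where "e = {a, b}"
        using simple_graph_edgeE[OF assms, of e] by blast
      ultimately show "e \<in> (\<lambda>y. {x, y}) ` {y. {x, y} \<in> E}"
        by (auto simp: insert_commute)
    qed auto
  qed
  then show ?thesis
    unfolding degree_def by (rule bij_betw_same_card[symmetric])
qed

lemma sum_laplacian_row:
  assumes "simple_graph E"
  shows "(\<Sum>z\<in>UNIV. laplacian E $ x $ z * g z) = (\<Sum>y | {x, y} \<in> E. g x - g y)"
proof -
  have "(\<Sum>z\<in>UNIV. laplacian E $ x $ z * g z) =
      (\<Sum>z\<in>UNIV. if x = z then real (degree E x) * g z else 0) - (\<Sum>z\<in>UNIV. if {x, z} \<in> E then g z else 0)"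
    unfolding sum_subtractf[symmetric] using simple_graph_irrefl[OF assms, of x x]
    by (intro sum.cong) (auto simp: laplacian_def degree_matrix_def adjacency_matrix_def adjacent_def)
  also have "\<dots> = real (degree E x) * g x - (\<Sum>y | {x, y} \<in> E. g y)"
    by (simp add: sum.If_cases)
  finally show ?thesis
    by (simp add: sum_subtractf degree_eq_card_neighbours[OF assms])
qed

text \<open>
  The order of summation over edges at \<open>x\<close> and trees is exchanged, after which each tree is treated
  on its own. The dependence on \<open>w\<close> then sits in the diagonal term alone, and the rest is a function
  of \<open>x\<close>, of which only its existence matters because the projection \<open>P\<close> annihilates it.
\<close>

lemma laplacian_mult_separation_matrix:
  assumes "simple_graph E"
  defines "\<tau> \<equiv> real (card (spanning_trees E))"
  shows "\<exists>c. laplacian E ** separation_matrix E = (\<chi> x w. c x) - (2 * \<tau>) *\<^sub>R mat 1"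
proof
  let ?ST = "spanning_trees E"
  define c where "c x = 2 * \<tau> - (\<Sum>T\<in>?ST. real (card {y. {x, y} \<in> T}))" for x
  have "(laplacian E ** separation_matrix E) $ x $ w = c x - (if x = w then 2 * \<tau> else 0)" for x w
  proof -
    let ?h = "\<lambda>T y. 2 * of_bool (reach (T - {{x, y}}) w y) - 1 :: real"
    have "(laplacian E ** separation_matrix E) $ x $ w =
        (\<Sum>y | {x, y} \<in> E. separation_matrix E $ x $ w - separation_matrix E $ y $ w)"
      by (simp add: matrix_matrix_mult_def sum_laplacian_row[OF assms(1)])
    also have "\<dots> = (\<Sum>y | {x, y} \<in> E. \<Sum>T | T \<in> ?ST \<and> {x, y} \<in> T. ?h T y)"
      by (intro sum.cong) (auto simp: separation_matrix_diff[OF assms(1)])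
    also have "\<dots> = (\<Sum>T\<in>?ST. \<Sum>y | y \<in> {y. {x, y} \<in> E} \<and> {x, y} \<in> T. ?h T y)"
      using sum.swap_restrict[of "{y. {x, y} \<in> E}" ?ST "\<lambda>y T. ?h T y" "\<lambda>y T. {x, y} \<in> T"] by simp
    also have "\<dots> = (\<Sum>T\<in>?ST. \<Sum>y | {x, y} \<in> T. ?h T y)"
      by (intro sum.cong) (auto simp: spanning_trees_def)
    also have "\<dots> = (\<Sum>T\<in>?ST. 2 * of_bool (w \<noteq> x) - real (card {y. {x, y} \<in> T}))"
    proof (rule sum.cong)
      fix T assume "T \<in> ?ST"
      then have "simple_graph T" "graph_forest T" "graph_connected T"
        using assms(1) simple_graph_subset by (auto simp: spanning_trees_def)
      note behind = card_tree_edges_behind[OF this, of x w]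
      have "(\<Sum>y | {x, y} \<in> T. of_bool (reach (T - {{x, y}}) w y) :: real) = of_bool (w \<noteq> x)"
        using behind by (simp add: Int_def of_bool_def sum.If_cases)
      then show "(\<Sum>y | {x, y} \<in> T. ?h T y) = 2 * of_bool (w \<noteq> x) - real (card {y. {x, y} \<in> T})"
        by (simp add: sum_subtractf sum_distrib_left[symmetric])
    qed simp
    also have "\<dots> = c x - (if x = w then 2 * \<tau> else 0)"
      by (simp add: c_def \<tau>_def sum_subtractf)
    finally show ?thesis .
  qed
  then show "laplacian E ** separation_matrix E = (\<chi> x w. c x) - (2 * \<tau>) *\<^sub>R mat 1"
    by (simp add: vec_eq_iff mat_def)
qed

section \<open>Counting roots\<close>

text \<open>
  For a forest with components \<open>A\<close> and \<open>B\<close>, the separated ordered pairs form the disjoint union of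
  \<open>A \<times> B\<close> and \<open>B \<times> A\<close>, while a choice of roots \<open>{a, b}\<close> is a single element of \<open>A \<times> B\<close>.
\<close>

lemma sum_separation_matrix:
  "(\<Sum>x\<in>UNIV. \<Sum>w\<in>UNIV. separation_matrix E $ x $ w) = 2 * real (card (rooted_spanning_2_forests E))"
proof -
  let ?S = "spanning_2_forests E"
  let ?R = "\<lambda>F. {R. \<forall>C\<in>graph_components F. \<exists>!r. r \<in> C \<and> r \<in> R}"
  have pairs: "(\<Sum>x\<in>UNIV. \<Sum>w\<in>UNIV. of_bool (\<not> reach F x w)) = 2 * real (card (?R F))"
    if F: "F \<in> ?S" for F
  proof -
    obtain A B where AB: "graph_components F = {A, B}" "A \<noteq> B"
      using F by (auto simp: spanning_2_forests_def card_2_iff)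
    have comp: "graph_component F x = C \<longleftrightarrow> x \<in> C" if "C \<in> {A, B}" for x C
    proof -
      have "C \<in> graph_components F" using AB(1) that by simp
      then obtain a where "C = graph_component F a"
        by (auto simp: graph_components_def)
      then show ?thesis
        using graph_component_eq_iff[of F a x] by (auto simp: graph_component_def)
    qed
    have disj: "A \<inter> B = {}" using comp[of A] comp[of B] AB(2) by auto
    have cover: "x \<in> A \<or> x \<in> B" for x
    proof -
      have "graph_component F x \<in> graph_components F"
        by (simp add: graph_components_def)
      then have "graph_component F x = A \<or> graph_component F x = B" using AB(1) by simp
      then show ?thesis using comp[of A x] comp[of B x] by simp
    qed
    have sep: "\<not> reach F x w \<longleftrightarrow> (x, w) \<in> A \<times> B \<union> B \<times> A" for x w
    proof -
      have "reach F x w \<longleftrightarrow> (x \<in> A \<longleftrightarrow> w \<in> A)"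
        unfolding graph_component_eq_iff[symmetric]
        using comp[of A x] comp[of A w] comp[of B x] comp[of B w] cover[of x] cover[of w] by auto
      then show ?thesis using cover[of x] cover[of w] disj by auto
    qed
    have "(\<Sum>x\<in>UNIV. \<Sum>w\<in>UNIV. of_bool (\<not> reach F x w)) =
        (\<Sum>p\<in>UNIV. of_bool (p \<in> A \<times> B \<union> B \<times> A) :: real)"
      unfolding sep sum.cartesian_product UNIV_Times_UNIV by (simp only: split_def prod.collapse)
    also have "\<dots> = real (card (A \<times> B \<union> B \<times> A))"
      unfolding of_bool_def
      by (subst sum.If_cases)
        (simp_all only: finite Collect_mem_eq Int_UNIV_left sum.neutral_const add_0_right, simp)
    also have "\<dots> = 2 * real (card (A \<times> B))"
      using disj by (subst card_Un_disjoint) (auto simp: card_cartesian_product)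
    also have "card (A \<times> B) = card (?R F)"
    proof (rule bij_betw_same_card)
      show "bij_betw (\<lambda>(a, b). {a, b}) (A \<times> B) (?R F)"
        unfolding bij_betw_def
      proof
        show "inj_on (\<lambda>(a, b). {a, b}) (A \<times> B)"
          using disj by (auto simp: inj_on_def doubleton_eq_iff)
        show "(\<lambda>(a, b). {a, b}) ` (A \<times> B) = ?R F"
        proof (intro equalityI subsetI)
          fix R assume "R \<in> ?R F"
          then have "\<exists>!a. a \<in> A \<and> a \<in> R" "\<exists>!b. b \<in> B \<and> b \<in> R"
            by (simp_all add: AB(1))
          then obtain a b where ab: "a \<in> A" "a \<in> R" "b \<in> B" "b \<in> R"
            and uniq: "\<And>r. r \<in> A \<Longrightarrow> r \<in> R \<Longrightarrow> r = a" "\<And>r. r \<in> B \<Longrightarrow> r \<in> R \<Longrightarrow> r = b"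
            by metis
          have "R = {a, b}"
            using ab uniq cover by fast
          then show "R \<in> (\<lambda>(a, b). {a, b}) ` (A \<times> B)"
            using ab by (intro image_eqI[of _ _ "(a, b)"]) simp_all
        next
          fix R assume "R \<in> (\<lambda>(a, b). {a, b}) ` (A \<times> B)"
          then obtain a b where ab: "R = {a, b}" "a \<in> A" "b \<in> B" by fast
          have "\<exists>!r. r \<in> A \<and> r \<in> R"
            using ab disj by (intro ex1I[of _ a]) fast+
          moreover have "\<exists>!r. r \<in> B \<and> r \<in> R"
            using ab disj by (intro ex1I[of _ b]) fast+
          ultimately show "R \<in> ?R F"
            by (simp add: AB(1))
        qed
      qed
    qed
    finally show ?thesis .
  qed
  have "rooted_spanning_2_forests E = Sigma ?S ?R"
    by (auto simp: rooted_spanning_2_forests_def)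
  then have card_rooted: "card (rooted_spanning_2_forests E) = (\<Sum>F\<in>?S. card (?R F))"
    by (simp add: card_SigmaI)
  have "(\<Sum>x\<in>UNIV. \<Sum>w\<in>UNIV. separation_matrix E $ x $ w) =
      (\<Sum>x\<in>UNIV. \<Sum>w\<in>UNIV. \<Sum>F\<in>?S. of_bool (\<not> reach F x w))"
    by (simp add: separation_matrix_def Int_def of_bool_def sum.If_cases)
  also have "\<dots> = (\<Sum>x\<in>UNIV. \<Sum>F\<in>?S. \<Sum>w\<in>UNIV. of_bool (\<not> reach F x w))"
    by (intro sum.cong refl sum.swap)
  also have "\<dots> = (\<Sum>F\<in>?S. \<Sum>x\<in>UNIV. \<Sum>w\<in>UNIV. of_bool (\<not> reach F x w))"
    by (rule sum.swap)
  also have "\<dots> = 2 * real (card (rooted_spanning_2_forests E))"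
    unfolding card_rooted of_nat_sum sum_distrib_left by (intro sum.cong refl pairs)
  finally show ?thesis .
qed

section \<open>The Green's function\<close>

text \<open>
  The matrices \<open>A X\<close> and \<open>A Y\<close> are orthogonal projections onto the same space, the range of \<open>A\<close>, so
  they agree. Likewise \<open>X A = Y A\<close>, and \<open>X = X A X\<close> depends only on these two products.
\<close>

lemma moore_penrose_inverse_unique:
  assumes "is_moore_penrose_inverse A X" "is_moore_penrose_inverse A Y"
  shows "X = Y"
proof -
  have X: "A ** X ** A = A" "X ** A ** X = X" "transpose (A ** X) = A ** X" "transpose (X ** A) = X ** A"
    and Y: "A ** Y ** A = A" "Y ** A ** Y = Y" "transpose (A ** Y) = A ** Y" "transpose (Y ** A) = Y ** A"
    using assms by (auto simp: is_moore_penrose_inverse_def)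
  have "A ** X = (A ** Y) ** (A ** X)"
    using Y(1) by (simp add: matrix_mul_assoc)
  also have "\<dots> = transpose (A ** Y) ** transpose (A ** X)"
    by (simp only: X Y)
  also have "\<dots> = transpose ((A ** X) ** (A ** Y))"
    by (simp only: matrix_transpose_mul)
  also have "(A ** X) ** (A ** Y) = A ** Y"
    using X(1) by (simp add: matrix_mul_assoc)
  finally have AX: "A ** X = A ** Y" by (simp only: Y)
  have "X ** A = (X ** A) ** (Y ** A)"
    using Y(1) by (simp add: matrix_mul_assoc[symmetric])
  also have "\<dots> = transpose (X ** A) ** transpose (Y ** A)"
    by (simp only: X Y)
  also have "\<dots> = transpose ((Y ** A) ** (X ** A))"
    by (simp only: matrix_transpose_mul)
  also have "(Y ** A) ** (X ** A) = Y ** A"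
    using X(1) by (simp add: matrix_mul_assoc[symmetric])
  finally have XA: "X ** A = Y ** A" by (simp only: Y)
  have "X = (X ** A) ** X" using X(2) by simp
  also have "\<dots> = Y ** (A ** X)" by (simp only: XA matrix_mul_assoc)
  also have "\<dots> = Y" using Y(2) by (simp only: AX matrix_mul_assoc)
  finally show ?thesis .
qed

lemma moore_penrose_inverse_eqI:
  "is_moore_penrose_inverse A X \<Longrightarrow> moore_penrose_inverse A = X"
  unfolding moore_penrose_inverse_def using moore_penrose_inverse_unique by blast

text \<open>
  The orthogonal projection onto the complement of the constant vectors.
\<close>

definition centering :: "real^'v^'v" where
  "centering = (\<chi> i j. (if i = j then 1 else 0) - 1 / real CARD('v))"

lemma transpose_centering: "transpose centering = centering"
  by (auto simp: transpose_def centering_def vec_eq_iff)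

lemma mult_centering_nth:
  fixes A :: "real^'v^'v"
  shows "(A ** centering) $ i $ j = A $ i $ j - (\<Sum>k\<in>UNIV. A $ i $ k) / real CARD('v)"
proof -
  have "(A ** centering) $ i $ j =
      (\<Sum>k\<in>UNIV. (if k = j then A $ i $ k else 0) - A $ i $ k / real CARD('v))"
    unfolding matrix_matrix_mult_def centering_def
    by (simp, intro sum.cong) (auto simp: right_diff_distrib)
  then show ?thesis by (simp add: sum_subtractf sum_divide_distrib)
qed

lemma centering_idem: "centering ** centering = (centering :: real^'v^'v)"
  by (simp add: vec_eq_iff mult_centering_nth) (simp add: centering_def sum_subtractf)

lemma transpose_laplacian: "transpose (laplacian E) = laplacian E"
  by (auto simp: transpose_def laplacian_def degree_matrix_def adjacency_matrix_def
      adjacent_commute vec_eq_iff)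

lemma laplacian_centering:
  assumes "simple_graph E"
  shows "laplacian E ** centering = laplacian E" "centering ** laplacian E = laplacian E"
proof -
  show *: "laplacian E ** centering = laplacian E"
    using sum_laplacian_row[OF assms, of _ "\<lambda>_. 1"] by (simp add: vec_eq_iff mult_centering_nth)
  show "centering ** laplacian E = laplacian E"
    using arg_cong[OF *, of transpose]
    by (simp add: matrix_transpose_mul transpose_laplacian transpose_centering)
qed

lemma transpose_separation_matrix: "transpose (separation_matrix E) = separation_matrix E"
  by (simp add: transpose_def separation_matrix_def reach_commute)

text \<open>
  Existence of the pseudoinverse comes with the formula: the Penrose conditions are checked for the
  right-hand side, and uniqueness of the pseudoinverse identifies it with the Green's function.
\<close>

lemma greens_function_eq:
  fixes E :: "'v::finite set set"
  assumes "simple_graph E" "graph_connected E"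
  shows "greens_function E = (- 1 / (2 * real (card (spanning_trees E)))) *\<^sub>R
    (centering ** separation_matrix E ** centering)"
proof -
  define \<tau> where "\<tau> = real (card (spanning_trees E))"
  define L P R where "L = laplacian E" and "P = (centering :: real^'v^'v)" and "R = separation_matrix E"
  define k where "k = - 1 / (2 * \<tau>)"
  define G where "G = k *\<^sub>R (P ** R ** P)"
  have "\<tau> \<noteq> 0"
    using spanning_tree_exists[OF assms] by (simp add: \<tau>_def)
  then have k: "k * - (2 * \<tau>) = 1" by (simp add: k_def)
  have LP: "L ** P = L" "P ** L = L" "P ** P = P" "transpose P = P" "transpose L = L" "transpose R = R"
    by (simp_all add: L_def P_def R_def laplacian_centering assms centering_idem transpose_centering
        transpose_laplacian transpose_separation_matrix)
  obtain c where c: "L ** R = (\<chi> x w. c x) - (2 * \<tau>) *\<^sub>R mat 1"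
    using laplacian_mult_separation_matrix[OF assms(1)] by (auto simp: L_def R_def \<tau>_def)
  have "L ** R ** P = - (2 * \<tau>) *\<^sub>R P"
    by (simp add: c vec_eq_iff P_def mult_centering_nth mat_def sum_subtractf)
       (simp add: centering_def diff_divide_distrib right_diff_distrib flip: sum_distrib_left)
  then have "L ** (P ** R ** P) = - (2 * \<tau>) *\<^sub>R P"
    by (simp add: matrix_mul_assoc LP)
  then have LG: "L ** G = P"
    by (simp only: G_def matrix_scalar_ac scalar_matrix_assoc[symmetric] scaleR_scaleR k scaleR_one)
  have "transpose G = G"
    by (simp add: G_def transpose_scalar matrix_transpose_mul LP matrix_mul_assoc)
  then have GL: "G ** L = P"
    using arg_cong[OF LG, of transpose] by (simp add: matrix_transpose_mul LP)
  have "P ** G = G"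
    by (simp add: G_def matrix_scalar_ac scalar_matrix_assoc[symmetric] matrix_mul_assoc LP)
  then have "is_moore_penrose_inverse L G"
    by (simp add: is_moore_penrose_inverse_def LG GL LP)
  then show ?thesis
    using moore_penrose_inverse_eqI
    by (simp only: greens_function_def G_def k_def L_def P_def R_def \<tau>_def)
qed

theorem corollary1p3:
  fixes E :: "'v::finite set set"
  assumes "simple_graph E" and "graph_connected E"
  shows "trace (greens_function E) =
    1 / (real CARD('v) * real (card (spanning_trees E))) * real (card (rooted_spanning_2_forests E))"
proof -
  let ?R = "separation_matrix E"
  \<comment> \<open>Cyclicity of the trace moves one projection next to the other.\<close>
  have "trace (centering ** ?R ** centering) = trace (?R ** centering)"
    by (metis trace_mul_sym matrix_mul_assoc centering_idem)
  also have "\<dots> = - (\<Sum>x\<in>UNIV. \<Sum>w\<in>UNIV. ?R $ x $ w) / real CARD('v)"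
    by (simp add: trace_def mult_centering_nth sum_subtractf sum_divide_distrib)
       (simp add: separation_matrix_def)
  also have "\<dots> = - 2 * real (card (rooted_spanning_2_forests E)) / real CARD('v)"
    by (simp add: sum_separation_matrix)
  finally have tr: "trace (centering ** ?R ** centering) = \<dots>" .
  have "trace (k *\<^sub>R A) = k * trace A" for k and A :: "real^'v^'v"
    by (simp add: trace_def sum_distrib_left)
  then have "trace (greens_function E) =
      - 1 / (2 * real (card (spanning_trees E))) * trace (centering ** ?R ** centering)"
    by (simp only: greens_function_eq[OF assms])
  then show ?thesis by (simp add: tr)
qed

end
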